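(* Consider the joint DRCCP with right-hand uncertainty $\min_{x\in\mathcal X}\{c^\top x:\mathbb{P}_\zeta\{\tilde\zeta_i+\theta\le x_i,\ \forall i\in[n]\}\ge1-\varepsilon\}$. Suppose that the deterministic set $\mathcal X\subseteq\mathbb{R}^n$ is convex and that the reference distribution $\mathbb{P}_\zeta$ is continuous with support $\mathbb{R}^n$. Then the lower-level ALSO-X problem $$v^A(t)=\min_{x\in\mathcal X}\Big\{\mathbb{E}_{\mathbb{P}_\zeta}\Big[\max_{i\in[n]}\big(\tilde\zeta_i+\theta-x_i\big)_+\Big] : c^\top x\le t\Big\}$$ admits a unique optimal solution when $t\ge\min_{x\in\mathcal X}c^\top x$ and $v^A(t)>0$.
   Context: $[n]=\{1,\dots,n\}$, $c\in\mathbb{R}^n$, $\varepsilon\in(0,1)$, $\theta\ge0$, $(y)_+=\max\{y,0\}$. $\tilde\zeta=(\tilde\zeta_1,\dots,\tilde\zeta_n)$ is a random vector in $\mathbb{R}^n$ with distribution $\mathbb{P}_\zeta$, assumed throughout to be sub-Gaussian: $\mathbb{P}_\zeta\{\|\tilde\zeta\|\ge\tau\}\le C_1\exp(-C_2\tau^2)$ for some constants $C_1,C_2>0$. "Continuous" means possessing a probability density. Convention: the minimization problem is understood to attain its minimum whenever it is feasible. *)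

theory Defs
  imports "HOL-Probability.Probability"
begin

definition sub_gaussian :: "(real ^ 'n) measure \<Rightarrow> bool" where
  "sub_gaussian P \<longleftrightarrow>
     (\<exists>C\<^sub>1 > 0. \<exists>C\<^sub>2 > 0. \<forall>\<tau> \<ge> 0.
        measure P {z. norm z \<ge> \<tau>} \<le> C\<^sub>1 * exp (- C\<^sub>2 * \<tau>\<^sup>2))"

definition has_density :: "(real ^ 'n) measure \<Rightarrow> bool" where
  "has_density P \<longleftrightarrow> (\<exists>f \<in> borel_measurable lborel. P = density lborel f)"

definition measure_support :: "'a::topological_space measure \<Rightarrow> 'a set" where
  "measure_support P = {z. \<forall>U. open U \<and> z \<in> U \<longrightarrow> emeasure P U > 0}"

text \<open>The optimal value lives in the extended reals: it is \<open>\<infinity>\<close> for an infeasible problem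
  and \<open>-\<infinity>\<close> for an unbounded one.\<close>

definition min_value :: "('a \<Rightarrow> real) \<Rightarrow> 'a set \<Rightarrow> ereal" where
  "min_value f S = (INF x\<in>S. ereal (f x))"

text \<open>The convention that the minimum of \<open>f\<close> over \<open>S\<close> is attained whenever the problem is
  feasible. Problems that are unbounded below are exempted, so that the convention does not
  rule them out.\<close>

definition attains_min :: "('a \<Rightarrow> real) \<Rightarrow> 'a set \<Rightarrow> bool" where
  "attains_min f S \<longleftrightarrow>
     (S \<noteq> {} \<and> bdd_below (f ` S) \<longrightarrow> (\<exists>x. is_arg_min f (\<lambda>x. x \<in> S) x))"

definition alsox_objective :: "(real ^ 'n) measure \<Rightarrow> real \<Rightarrow> real ^ 'n \<Rightarrow> real" where
  "alsox_objective P \<theta> x = (\<integral>z. (MAX i. max (z $ i + \<theta> - x $ i) 0) \<partial>P)"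

definition alsox_feasible :: "(real ^ 'n) set \<Rightarrow> real ^ 'n \<Rightarrow> real \<Rightarrow> (real ^ 'n) set" where
  "alsox_feasible X c t = {x \<in> X. c \<bullet> x \<le> t}"

definition alsox_value ::
    "(real ^ 'n) measure \<Rightarrow> real \<Rightarrow> (real ^ 'n) set \<Rightarrow> real ^ 'n \<Rightarrow> real \<Rightarrow> ereal" where
  "alsox_value P \<theta> X c t = min_value (alsox_objective P \<theta>) (alsox_feasible X c t)"

end

theory Submission
  imports Defs
begin

text \<open>The objective of the lower-level problem is strictly convex in the midpoint sense, and a
  strictly convex function has at most one minimiser on a convex set. Pointwise in the scenario
  \<open>z\<close>, the excess \<open>max\<^sub>i (z\<^sub>i + \<theta> - x\<^sub>i)\<^sub>+\<close> is convex in \<open>x\<close>. If \<open>x\<^sub>k < y\<^sub>k\<close> and \<open>m\<close> is the midpoint,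
  then in every scenario with \<open>x\<^sub>k < z\<^sub>k + \<theta> < m\<^sub>k\<close> and \<open>z\<^sub>i + \<theta> < m\<^sub>i\<close> for all \<open>i\<close> the excess
  vanishes at \<open>m\<close> but not at \<open>x\<close>. These scenarios form a nonempty open set, which has positive
  probability because the support is the whole space, so the convexity inequality is strict after
  taking expectations (\<open>alsox_objective_midpoint_less\<close>).

  Expectations may be compared like this only if they are finite; the sub-Gaussian tail bound
  supplies this through a finite first moment of the norm (\<open>integrable_norm_sub_gaussian\<close>).
  Existence of a minimiser is the attainment convention, once the problem is known to be
  feasible.\<close>

definition excess :: "real \<Rightarrow> real ^ 'n \<Rightarrow> real ^ 'n \<Rightarrow> real" where
  "excess \<theta> x z = (MAX i. max (z $ i + \<theta> - x $ i) 0)"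

lemma excess_le_iff: "excess \<theta> x z \<le> a \<longleftrightarrow> 0 \<le> a \<and> (\<forall>i. z $ i + \<theta> - x $ i \<le> a)"
  unfolding excess_def by (subst Max_le_iff) auto

lemma excess_nonneg: "0 \<le> excess \<theta> x z"
  using excess_le_iff[of \<theta> x z "excess \<theta> x z"] by simp

lemma component_le_excess: "z $ i + \<theta> - x $ i \<le> excess \<theta> x z"
  using excess_le_iff[of \<theta> x z "excess \<theta> x z"] by simp

lemma excess_midpoint_le:
  "excess \<theta> ((1/2) *\<^sub>R x + (1/2) *\<^sub>R y) z \<le> (excess \<theta> x z + excess \<theta> y z) / 2"
proof -
  have "z $ i + \<theta> - ((1/2) *\<^sub>R x + (1/2) *\<^sub>R y) $ i \<le> (excess \<theta> x z + excess \<theta> y z) / 2" for i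
    using component_le_excess[of z i \<theta> x] component_le_excess[of z i \<theta> y] by simp
  then show ?thesis
    using excess_nonneg[of \<theta> x z] excess_nonneg[of \<theta> y z] unfolding excess_le_iff by simp
qed

lemma borel_measurable_excess [measurable]: "excess \<theta> x \<in> borel_measurable borel"
proof (rule borel_measurableI_le)
  fix a
  have "closed {z. excess \<theta> x z \<le> a}"
    unfolding excess_le_iff
    by (intro closed_Collect_conj closed_Collect_all closed_Collect_le continuous_intros)
  then show "{z \<in> space borel. excess \<theta> x z \<le> a} \<in> sets borel"
    by simp
qed

text \<open>The norm rounded up to an integer has expectation \<open>\<Sum>n. P (norm z > n)\<close>, and the
  Gaussian tail is dominated by a geometric series in \<open>n\<close> because \<open>n \<le> n\<^sup>2\<close>.\<close>

lemma integrable_norm_sub_gaussian: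
  fixes P :: "(real ^ 'n) measure"
  assumes "prob_space P" and sets: "sets P = sets borel" and "sub_gaussian P"
  shows "integrable P norm"
proof -
  interpret prob_space P by fact
  note [measurable_cong] = sets
  obtain A B where "A > 0" "B > 0"
    and tail: "\<And>\<tau>. 0 \<le> \<tau> \<Longrightarrow> measure P {z. norm z \<ge> \<tau>} \<le> A * exp (- B * \<tau>\<^sup>2)"
    using \<open>sub_gaussian P\<close> unfolding sub_gaussian_def by blast
  have space: "space P = UNIV"
    using sets_eq_imp_space_eq[OF sets] by simp
  have tail_le: "emeasure P {z \<in> space P. n < nat \<lceil>norm z\<rceil>} \<le> ennreal (A * exp (- B) ^ n)" for n
  proof -
    have "emeasure P {z \<in> space P. n < nat \<lceil>norm z\<rceil>} \<le> emeasure P {z. norm z \<ge> real n}"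
    proof (rule emeasure_mono)
      show "{z \<in> space P. n < nat \<lceil>norm z\<rceil>} \<subseteq> {z. norm z \<ge> real n}"
        by (auto simp: zless_nat_eq_int_zless less_ceiling_iff)
    qed (auto simp: sets)
    also have "\<dots> = ennreal (measure P {z. norm z \<ge> real n})"
      by (rule emeasure_eq_measure)
    also have "\<dots> \<le> ennreal (A * exp (- B * (real n)\<^sup>2))"
      by (intro ennreal_leI tail) simp
    also have "\<dots> \<le> ennreal (A * exp (- B * real n))"
    proof -
      have "real n \<le> (real n)\<^sup>2"
        by (metis of_nat_le_iff of_nat_power power2_nat_le_imp_le le_refl power2_eq_square le_square)
      then show ?thesis
        using \<open>A > 0\<close> \<open>B > 0\<close> by (intro ennreal_leI mult_left_mono) auto
    qed
    also have "A * exp (- B * real n) = A * exp (- B) ^ n"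
      by (simp add: exp_of_nat_mult[symmetric] mult.commute)
    finally show ?thesis .
  qed
  have "(\<integral>\<^sup>+ z. ennreal (norm z) \<partial>P) \<le> (\<integral>\<^sup>+ z. of_nat (nat \<lceil>norm z\<rceil>) \<partial>P)"
  proof (rule nn_integral_mono)
    fix z :: "real ^ 'n"
    have "ennreal (norm z) \<le> ennreal (real (nat \<lceil>norm z\<rceil>))"
      by (intro ennreal_leI) linarith
    then show "ennreal (norm z) \<le> of_nat (nat \<lceil>norm z\<rceil>)"
      by (simp add: ennreal_of_nat_eq_real_of_nat)
  qed
  also have "\<dots> = (\<Sum>n. emeasure P {z \<in> space P. n < nat \<lceil>norm z\<rceil>})"
    by (rule nn_integral_nat_function) measurable
  also have "\<dots> \<le> (\<Sum>n. ennreal (A * exp (- B) ^ n))"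
    by (intro suminf_le tail_le) auto
  also have "\<dots> < \<infinity>"
  proof -
    have "summable (\<lambda>n. A * exp (- B) ^ n)"
      using \<open>B > 0\<close> by (intro summable_mult summable_geometric) simp
    then show ?thesis
      using \<open>A > 0\<close> by (subst suminf_ennreal2) auto
  qed
  finally show ?thesis
    by (intro integrableI_bounded) (auto simp: measurable_cong_sets[OF sets refl])
qed

lemma integrable_excess:
  fixes P :: "(real ^ 'n) measure"
  assumes "prob_space P" and sets: "sets P = sets borel" and "sub_gaussian P"
  shows "integrable P (excess \<theta> x)"
proof -
  interpret prob_space P by fact
  note [measurable_cong] = sets
  have bound: "excess \<theta> x z \<le> norm z + \<bar>\<theta>\<bar> + norm x" for z
  proof -
    have "z $ i + \<theta> - x $ i \<le> norm z + \<bar>\<theta>\<bar> + norm x" for i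
      using component_le_norm_cart[of z i] component_le_norm_cart[of x i] by linarith
    then show ?thesis
      by (simp add: excess_le_iff)
  qed
  have "integrable P (\<lambda>z. norm z + \<bar>\<theta>\<bar> + norm x)"
    using integrable_norm_sub_gaussian[OF assms] by simp
  then show ?thesis
  proof (rule Bochner_Integration.integrable_bound)
    show "AE z in P. norm (excess \<theta> x z) \<le> norm (norm z + \<bar>\<theta>\<bar> + norm x)"
      using order_trans[OF bound abs_ge_self] by (intro always_eventually) (simp add: excess_nonneg)
  qed measurable
qed

lemma alsox_objective_eq: "alsox_objective P \<theta> x = (\<integral>z. excess \<theta> x z \<partial>P)"
  unfolding alsox_objective_def excess_def ..

lemma alsox_objective_nonneg: "0 \<le> alsox_objective P \<theta> x"
  unfolding alsox_objective_eq by (simp add: excess_nonneg)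

text \<open>The coordinates are ordered by \<open>x\<^sub>k < y\<^sub>k\<close> only to know at which endpoint the excess is
  positive; the symmetric version follows.\<close>

lemma alsox_objective_midpoint_less_aux:
  fixes P :: "(real ^ 'n) measure"
  assumes P: "prob_space P" "sets P = sets borel" "sub_gaussian P"
    and supp: "measure_support P = UNIV"
    and less: "x $ k < y $ k"
  shows "alsox_objective P \<theta> ((1/2) *\<^sub>R x + (1/2) *\<^sub>R y)
    < (alsox_objective P \<theta> x + alsox_objective P \<theta> y) / 2"
proof -
  define m where "m = (1/2) *\<^sub>R x + (1/2) *\<^sub>R y"
  define gap where "gap z = (excess \<theta> x z + excess \<theta> y z) / 2 - excess \<theta> m z" for z
  define U where "U = {z. x $ k < z $ k + \<theta> \<and> (\<forall>i. z $ i + \<theta> < m $ i)}"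
  note int = integrable_excess[OF P]
  have gap_nonneg: "0 \<le> gap z" for z
    using excess_midpoint_le[of \<theta> x y z] by (simp add: gap_def m_def)
  have gap_pos: "0 < gap z" if "z \<in> U" for z
  proof -
    have "excess \<theta> m z \<le> 0"
      using that by (auto simp: excess_le_iff U_def algebra_simps less_imp_le)
    moreover have "0 < excess \<theta> x z"
      using that component_le_excess[of z k \<theta> x] by (simp add: U_def)
    ultimately show ?thesis
      using excess_nonneg[of \<theta> y z] by (simp add: gap_def)
  qed
  have open_U: "open U"
  proof -
    have "U = {z. x $ k < z $ k + \<theta>} \<inter> (\<Inter>i. {z. z $ i + \<theta> < m $ i})"
      by (auto simp: U_def)
    then show ?thesis
      by (auto intro!: open_Int open_INT open_Collect_less continuous_intros)
  qed
  have "x $ k < m $ k"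
    using less by (simp add: m_def)
  \<comment> \<open>The scenario whose shift by \<open>\<theta>\<close> lies below \<open>m\<close> by half of \<open>m\<^sub>k - x\<^sub>k\<close> in every coordinate.\<close>
  then have "(\<chi> i. m $ i - \<theta> - (m $ k - x $ k) / 2) \<in> U"
    by (simp add: U_def field_simps)
  then have U_pos: "0 < emeasure P U"
    using supp open_U by (auto simp: measure_support_def)
  have "integrable P gap"
    unfolding gap_def using int by simp
  moreover have "(\<integral>z. gap z \<partial>P) \<noteq> 0"
  proof
    assume "(\<integral>z. gap z \<partial>P) = 0"
    then have "AE z in P. gap z = 0"
      using \<open>integrable P gap\<close> gap_nonneg by (subst (asm) integral_nonneg_eq_0_iff_AE) auto
    then have "AE z in P. z \<notin> U"
      by (rule eventually_mono) (use gap_pos in force)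
    then have "emeasure P U = 0"
      using open_U P(2) sets_eq_imp_space_eq[OF P(2)] by (subst (asm) AE_iff_measurable) auto
    with U_pos show False by simp
  qed
  ultimately have "0 < (\<integral>z. gap z \<partial>P)"
    using gap_nonneg by (simp add: less_le)
  also have "(\<integral>z. gap z \<partial>P)
      = (alsox_objective P \<theta> x + alsox_objective P \<theta> y) / 2 - alsox_objective P \<theta> m"
    unfolding gap_def alsox_objective_eq using int by simp
  finally show ?thesis
    by (simp add: m_def)
qed

lemma alsox_objective_midpoint_less:
  fixes P :: "(real ^ 'n) measure"
  assumes "prob_space P" "sets P = sets borel" "sub_gaussian P"
    and "measure_support P = UNIV" and "x \<noteq> y"
  shows "alsox_objective P \<theta> ((1/2) *\<^sub>R x + (1/2) *\<^sub>R y)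
    < (alsox_objective P \<theta> x + alsox_objective P \<theta> y) / 2"
proof -
  obtain k where "x $ k \<noteq> y $ k"
    using \<open>x \<noteq> y\<close> by (auto simp: vec_eq_iff)
  then consider "x $ k < y $ k" | "y $ k < x $ k"
    by linarith
  then show ?thesis
    using alsox_objective_midpoint_less_aux[OF assms(1-4), of x k y \<theta>]
      alsox_objective_midpoint_less_aux[OF assms(1-4), of y k x \<theta>]
    by cases (simp_all add: add.commute)
qed

lemma convex_alsox_feasible: "convex X \<Longrightarrow> convex (alsox_feasible X c t)"
  unfolding alsox_feasible_def
  by (simp add: convex_Int convex_halfspace_le Collect_conj_eq)

text \<open>When \<open>c \<bullet> x\<close> is bounded below on \<open>X\<close>, a minimiser is itself feasible, even for \<open>t\<close> equal to
  the minimum; otherwise some point of \<open>X\<close> lies below any level \<open>t\<close>.\<close>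

lemma alsox_feasible_nonempty:
  assumes attains: "attains_min (\<lambda>x. c \<bullet> x) X"
    and le: "min_value (\<lambda>x. c \<bullet> x) X \<le> ereal t"
  shows "alsox_feasible X c t \<noteq> {}"
proof (cases "bdd_below ((\<lambda>x. c \<bullet> x) ` X)")
  case True
  have "X \<noteq> {}"
    using le by (auto simp: min_value_def top_ereal_def)
  with True attains obtain x where x: "is_arg_min (\<lambda>x. c \<bullet> x) (\<lambda>x. x \<in> X) x"
    by (auto simp: attains_min_def)
  then have "ereal (c \<bullet> x) \<le> min_value (\<lambda>x. c \<bullet> x) X"
    unfolding min_value_def by (intro INF_greatest) (auto simp: is_arg_min_linorder)
  with le have "c \<bullet> x \<le> t"
    using order_trans by fastforce
  with x show ?thesis
    by (auto simp: alsox_feasible_def is_arg_min_def)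
next
  case False
  then obtain x where "x \<in> X" "c \<bullet> x < t"
    unfolding bdd_below_def by (metis imageE not_le)
  then show ?thesis
    by (auto simp: alsox_feasible_def intro: less_imp_le)
qed

theorem theorem6:
  fixes P :: "(real ^ 'n) measure"
    and X :: "(real ^ 'n) set"
    and c :: "real ^ 'n"
    and \<epsilon> \<theta> t :: real
  assumes "0 < \<epsilon>" and "\<epsilon> < 1"
    and "0 \<le> \<theta>"
    and "prob_space P" and "sets P = sets borel"
    and "sub_gaussian P"
    and "has_density P"
    and "measure_support P = UNIV"
    and "convex X"
    and "attains_min (\<lambda>x. c \<bullet> x) X"
    and "attains_min (alsox_objective P \<theta>) (alsox_feasible X c t)"
    and "min_value (\<lambda>x. c \<bullet> x) X \<le> ereal t"
    and "0 < alsox_value P \<theta> X c t"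
  shows "\<exists>!x. is_arg_min (alsox_objective P \<theta>) (\<lambda>x. x \<in> alsox_feasible X c t) x"
proof -
  let ?F = "alsox_feasible X c t" and ?g = "alsox_objective P \<theta>"
  have "bdd_below (?g ` ?F)"
    by (rule bdd_belowI2[of _ 0]) (rule alsox_objective_nonneg)
  with assms(11) alsox_feasible_nonempty[OF assms(10) assms(12)]
  have "\<exists>x. is_arg_min ?g (\<lambda>x. x \<in> ?F) x"
    by (auto simp: attains_min_def)
  moreover have "x = y"
    if x: "is_arg_min ?g (\<lambda>x. x \<in> ?F) x" and y: "is_arg_min ?g (\<lambda>x. x \<in> ?F) y" for x y
  proof (rule ccontr)
    assume "x \<noteq> y"
    define m where "m = (1/2) *\<^sub>R x + (1/2) *\<^sub>R y"
    have "m \<in> ?F"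
      unfolding m_def using x y by (intro convexD[OF convex_alsox_feasible[OF assms(9)]]) (auto simp: is_arg_min_def)
    then have "?g x \<le> ?g m" "?g y \<le> ?g m"
      using x y by (auto simp: is_arg_min_linorder)
    moreover have "?g m < (?g x + ?g y) / 2"
      unfolding m_def by (rule alsox_objective_midpoint_less[OF assms(4-6,8) \<open>x \<noteq> y\<close>])
    ultimately show False
      by simp
  qed
  ultimately show ?thesis
    by blast
qed

end
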